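(* Let $\mathsf{S}$ be a cancellative monoid with neutral element $e$, and let $\mathfrak{R}$ be an associative ring with a finite $\mathsf{S}$-grading of order $d$. If $\mathfrak{R}_e$ is central in $\mathfrak{R}$ and $d\in\{1,2,3\}$, then $[x_1,\dots,x_{d+1}]\equiv0$ in $\mathfrak{R}$, that is, $[a_1,\dots,a_{d+1}]=0$ for all $a_1,\dots,a_{d+1}\in\mathfrak{R}$.
   Context: Rings are associative and not necessarily unital. A monoid is cancellative if $\xi\zeta=\tau\zeta$ implies $\xi=\tau$ and $\zeta\xi=\zeta\tau$ implies $\xi=\tau$. An $\mathsf{S}$-grading on $\mathfrak{R}$ is a decomposition $\mathfrak{R}=\bigoplus_{\xi\in\mathsf{S}}\mathfrak{R}_\xi$ into additive subgroups with $\mathfrak{R}_\xi\mathfrak{R}_\zeta\subseteq\mathfrak{R}_{\xi\zeta}$; its support is $\{\xi\in\mathsf{S}:\mathfrak{R}_\xi\neq\{0\}\}$, and the grading is finite of order $d$ if its support has exactly $d$ elements. "$\mathfrak{R}_e$ is central" means $\mathfrak{R}_e$ is contained in the center of $\mathfrak{R}$. Commutators are left-normed: $[a,b]=ab-ba$ and $[a_1,\dots,a_m]=[[a_1,\dots,a_{m-1}],a_m]$. *)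

theory Defs
  imports Main
begin

text \<open>
  The class \<^class>\<open>ring\<close> is that of associative, not necessarily unital rings.
  A grading is a family \<open>R\<close> of subsets of the ambient ring, indexed by a monoid type whose
  neutral element is \<open>1\<close>.
\<close>

definition additive_subgroup :: "'a::ab_group_add set \<Rightarrow> bool" where
  "additive_subgroup H \<longleftrightarrow>
     0 \<in> H \<and> (\<forall>x\<in>H. \<forall>y\<in>H. x + y \<in> H) \<and> (\<forall>x\<in>H. - x \<in> H)"

text \<open>
  The whole ring is the internal direct sum of the family: every element has a unique
  decomposition into components, all but finitely many of them zero.
\<close>

definition internal_direct_sum :: "('s \<Rightarrow> 'a::ab_group_add set) \<Rightarrow> bool" where
  "internal_direct_sum R \<longleftrightarrow>
     (\<forall>x. \<exists>!f. (\<forall>s. f s \<in> R s) \<and> finite {s. f s \<noteq> 0} \<and> x = (\<Sum>s | f s \<noteq> 0. f s))"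

definition grading :: "('s::monoid_mult \<Rightarrow> 'a::ring set) \<Rightarrow> bool" where
  "grading R \<longleftrightarrow>
     (\<forall>s. additive_subgroup (R s)) \<and>
     internal_direct_sum R \<and>
     (\<forall>s t. \<forall>x\<in>R s. \<forall>y\<in>R t. x * y \<in> R (s * t))"

definition grading_support :: "('s \<Rightarrow> 'a::zero set) \<Rightarrow> 's set" where
  "grading_support R = {s. R s \<noteq> {0}}"

definition finite_grading :: "('s::monoid_mult \<Rightarrow> 'a::ring set) \<Rightarrow> nat \<Rightarrow> bool" where
  "finite_grading R d \<longleftrightarrow>
     grading R \<and> finite (grading_support R) \<and> card (grading_support R) = d"

definition ring_center :: "'a::ring set" where
  "ring_center = {z. \<forall>x. z * x = x * z}"

definition commutator :: "'a::ring \<Rightarrow> 'a \<Rightarrow> 'a" where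
  "commutator a b = a * b - b * a"

text \<open>
  The left-normed commutator of a nonempty list.  The value on the empty list is an arbitrary
  convention.
\<close>

fun left_normed_commutator :: "'a::ring list \<Rightarrow> 'a" where
  "left_normed_commutator [] = 0"
| "left_normed_commutator (a # as) = foldl commutator a as"

lemma left_normed_commutator_singleton: "left_normed_commutator [a] = a"
  by simp

lemma left_normed_commutator_snoc:
  "as \<noteq> [] \<Longrightarrow>
     left_normed_commutator (as @ [b]) = commutator (left_normed_commutator as) b"
  by (cases as) simp_all

end

theory Submission
  imports Defs "HOL.Modules"
begin

text \<open>
  Left-normed commutators are additive in each entry, so only homogeneous entries matter.  The proof
  then depends on whether the neutral component \<open>R 1\<close> vanishes.

  If \<open>R 1 = {0}\<close>, every product of more than \<open>d\<close> homogeneous elements is zero, for every \<open>d\<close>: if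
  it were nonzero, the degrees of its prefixes would all lie in the support, so by the
  pigeonhole principle two of them would agree, and by cancellation the segment between these
  prefixes would have degree \<open>1\<close>, hence be zero (lemma \<open>word_prod_eq_0\<close>).  A
  left-normed commutator of length \<open>d + 1\<close> is a signed sum of such products.

  If \<open>R 1 \<noteq> {0}\<close>, at most two degrees other than \<open>1\<close> occur, and it is enough that the
  left-normed commutator of the first \<open>d\<close> homogeneous entries lies in \<open>R 1\<close>, which is central.
  Cancellation says that \<open>s * t\<close> is neither \<open>s\<close> nor \<open>t\<close> when \<open>s\<close> and \<open>t\<close> differ from \<open>1\<close>.  Thus, when
  the support is \<open>{1, s, t}\<close>, a product of elements of degrees \<open>s\<close> and \<open>t\<close> always falls into \<open>R 1\<close>.
  Up to exchanging \<open>s\<close> and \<open>t\<close>, the only triple commutator of elements of degree \<open>s\<close> or \<open>t\<close> that is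
  not in \<open>R 1\<close> by its degrees alone, or by the centrality of \<open>[a, b]\<close>, is \<open>[a, b, c]\<close> with
  \<open>a\<close>, \<open>b\<close> of degree \<open>s\<close> and \<open>c\<close> of degree \<open>t = s * s\<close>.  There \<open>b * c\<close> and \<open>c * a\<close> are central,
  so \<open>a\<close>, \<open>b\<close> and \<open>c\<close> may be permuted cyclically in their product and \<open>[a, b, c] = 0\<close>
  (lemma \<open>commutator_mult_eq_0\<close>).
\<close>

section \<open>Commutators\<close>

lemma commutator_add_left: "commutator (a + b) c = commutator a c + commutator b c"
  for a b c :: "'a::ring"
  by (simp add: commutator_def algebra_simps)

lemma commutator_add_right: "commutator a (b + c) = commutator a b + commutator a c"
  for a b c :: "'a::ring"
  by (simp add: commutator_def algebra_simps)

lemma commutator_minus_left: "commutator (a - b) c = commutator a c - commutator b c"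
  for a b c :: "'a::ring"
  by (simp add: commutator_def algebra_simps)

lemma commutator_zero_left [simp]: "commutator 0 b = 0"
  for b :: "'a::ring"
  by (simp add: commutator_def)

lemma commutator_center_left: "z \<in> ring_center \<Longrightarrow> commutator z a = 0"
  by (simp add: commutator_def ring_center_def)

lemma commutator_center_right: "z \<in> ring_center \<Longrightarrow> commutator a z = 0"
  by (simp add: commutator_def ring_center_def)

text \<open>
  Both hypotheses let \<open>a * b * c\<close> be rotated: \<open>a (b c) = (b c) a = b (c a) = (c a) b\<close>.
\<close>

lemma commutator_mult_eq_0:
  fixes a b c :: "'a::ring"
  assumes "b * c \<in> ring_center" and "c * a \<in> ring_center"
  shows "commutator (a * b) c = 0"
proof -
  have "a * b * c = b * c * a"
    using assms(1) by (simp add: ring_center_def mult.assoc)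
  also have "\<dots> = c * a * b"
    using assms(2) by (simp add: ring_center_def mult.assoc)
  finally show ?thesis
    by (simp add: commutator_def mult.assoc)
qed

lemma additive_foldl_commutator: "additive (\<lambda>x. foldl commutator x ys)"
proof (induction ys)
  case Nil
  show ?case by (simp add: additive_def)
next
  case (Cons y ys)
  then show ?case by (simp add: additive_def commutator_add_left)
qed

lemma additive_left_normed_commutator:
  "additive (\<lambda>x. left_normed_commutator (xs @ x # ys))"
proof (cases xs)
  case Nil
  then show ?thesis
    using additive_foldl_commutator[of ys] by simp
next
  case (Cons z zs)
  then show ?thesis
    using additive_foldl_commutator[of ys]
    by (simp add: additive_def commutator_add_right)
qed

section \<open>Products of nonempty lists\<close>

text \<open>
  The ring need not have a unit, so the empty product has no meaning; its value here is an arbitrary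
  convention.
\<close>

fun word_prod :: "'a::ring list \<Rightarrow> 'a" where
  "word_prod [] = 0"
| "word_prod [x] = x"
| "word_prod (x # y # ys) = x * word_prod (y # ys)"

lemma word_prod_Cons: "xs \<noteq> [] \<Longrightarrow> word_prod (x # xs) = x * word_prod xs"
  by (cases xs) simp_all

lemma word_prod_append:
  "xs \<noteq> [] \<Longrightarrow> ys \<noteq> [] \<Longrightarrow> word_prod (xs @ ys) = word_prod xs * word_prod ys"
  by (induction xs rule: word_prod.induct) (simp_all add: word_prod_Cons mult.assoc)

lemma word_prod_eq_0_if_segment_eq_0:
  assumes "ys \<noteq> []" and "word_prod ys = 0"
  shows "word_prod (xs @ ys @ zs) = 0"
proof -
  have "word_prod (ys @ zs) = 0"
    using assms by (cases "zs = []") (simp_all add: word_prod_append)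
  then show ?thesis
    using assms by (cases "xs = []") (simp_all add: word_prod_append)
qed

text \<open>
  A left-normed commutator is a signed sum of products of its entries in various orders.  The
  additive map \<open>f\<close> stands for what is still multiplied around the commutator of
  an initial segment, which makes the induction go through without writing that sum down.
\<close>

lemma additive_left_normed_commutator_eq_0:
  assumes "additive f"
    and "\<And>ys. length ys = length xs \<Longrightarrow> set ys \<subseteq> H \<Longrightarrow> f (word_prod ys) = 0"
    and "xs \<noteq> []" and "set xs \<subseteq> H"
  shows "f (left_normed_commutator xs) = 0"
  using assms(3,1,2,4)
proof (induction xs arbitrary: f rule: rev_nonempty_induct)
  case (single x)
  from single.prems(2)[of "[x]"] single.prems(3) show ?case
    by simp
next
  case (snoc b xs)
  let ?L = "left_normed_commutator xs"
  have "f (?L * b) = 0"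
  proof (rule snoc.IH)
    show "additive (\<lambda>x. f (x * b))"
      using snoc.prems(1) by (simp add: additive_def distrib_right)
    show "f (word_prod ys * b) = 0" if "length ys = length xs" "set ys \<subseteq> H" for ys
      using snoc.prems(2)[of "ys @ [b]"] snoc.prems(3) snoc.hyps that
      by (cases "ys = []") (auto simp add: word_prod_append)
  qed (use snoc.prems(3) in simp)
  moreover have "f (b * ?L) = 0"
  proof (rule snoc.IH)
    show "additive (\<lambda>x. f (b * x))"
      using snoc.prems(1) by (simp add: additive_def distrib_left)
    show "f (b * word_prod ys) = 0" if "length ys = length xs" "set ys \<subseteq> H" for ys
      using snoc.prems(2)[of "b # ys"] snoc.prems(3) snoc.hyps that
      by (cases "ys = []") (auto simp add: word_prod_Cons)
  qed (use snoc.prems(3) in simp)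
  ultimately show ?case
    using snoc.hyps additive.diff[OF snoc.prems(1), of "?L * b" "b * ?L"]
    by (simp add: left_normed_commutator_snoc commutator_def)
qed

section \<open>Gradings by a cancellative monoid\<close>

locale cancellative_grading =
  fixes R :: "'s::monoid_mult \<Rightarrow> 'a::ring set"
  assumes cancel_right: "\<And>\<xi> \<tau> \<zeta> :: 's. \<xi> * \<zeta> = \<tau> * \<zeta> \<Longrightarrow> \<xi> = \<tau>"
    and cancel_left: "\<And>\<xi> \<tau> \<zeta> :: 's. \<zeta> * \<xi> = \<zeta> * \<tau> \<Longrightarrow> \<xi> = \<tau>"
    and grading: "grading R"
begin

definition homogeneous :: "'a set" where
  "homogeneous = (\<Union>s. R s)"

lemma zero_mem: "0 \<in> R s"
  using grading by (simp add: grading_def additive_subgroup_def)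

lemma diff_mem:
  assumes "x \<in> R s" and "y \<in> R s"
  shows "x - y \<in> R s"
proof -
  have "x + - y \<in> R s"
    using grading assms unfolding grading_def additive_subgroup_def by blast
  then show ?thesis by simp
qed

lemma mult_mem: "x \<in> R s \<Longrightarrow> y \<in> R t \<Longrightarrow> x * y \<in> R (s * t)"
  using grading by (simp add: grading_def)

lemma mult_eq_left_iff: "s * t = s \<longleftrightarrow> t = 1" for s t :: 's
  using cancel_left[of s t 1] by auto

lemma mult_eq_right_iff: "s * t = t \<longleftrightarrow> s = 1" for s t :: 's
  using cancel_right[of s t 1] by auto

lemma additive_eq_0_if_homogeneous_eq_0:
  assumes "additive f" and "\<And>x. x \<in> homogeneous \<Longrightarrow> f x = 0"
  shows "f x = 0"
proof -
  from grading obtain g where "\<forall>s. g s \<in> R s" and x: "x = (\<Sum>s | g s \<noteq> 0. g s)"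
    unfolding grading_def internal_direct_sum_def by blast
  then have "f (g s) = 0" for s
    using assms(2) by (auto simp add: homogeneous_def)
  then show ?thesis
    unfolding x additive.sum[OF assms(1)] by simp
qed

text \<open>
  Homogeneous entries are replaced by arbitrary ones from left to right: the entries \<open>xs\<close> are
  already arbitrary, the entries \<open>ys\<close> still homogeneous.
\<close>

lemma left_normed_commutator_eq_0_if_homogeneous:
  assumes "\<And>xs. length xs = n \<Longrightarrow> set xs \<subseteq> homogeneous \<Longrightarrow> left_normed_commutator xs = 0"
    and "length xs = n"
  shows "left_normed_commutator (xs :: 'a list) = 0"
proof -
  have "left_normed_commutator (xs @ ys) = 0"
    if "length (xs @ ys) = n" and "set ys \<subseteq> homogeneous" for xs ys :: "'a list"
    using that
  proof (induction xs arbitrary: ys rule: rev_induct)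
    case Nil
    then show ?case using assms(1) by simp
  next
    case (snoc x xs)
    have "left_normed_commutator (xs @ x # ys) = 0"
    proof (rule additive_eq_0_if_homogeneous_eq_0[OF additive_left_normed_commutator])
      fix y assume "y \<in> homogeneous"
      then show "left_normed_commutator (xs @ y # ys) = 0"
        using snoc.prems by (intro snoc.IH) simp_all
    qed
    then show ?case by simp
  qed
  from this[of xs "[]"] assms(2) show ?thesis by simp
qed

section \<open>Trivial neutral component\<close>

lemma word_prod_mem:
  "list_all2 (\<lambda>x s. x \<in> R s) xs ss \<Longrightarrow> xs \<noteq> [] \<Longrightarrow> word_prod xs \<in> R (prod_list ss)"
proof (induction rule: list_all2_induct)
  case Nil
  then show ?case by simp
next
  case (Cons x xs s ss)
  then show ?case
    by (cases "xs = []") (auto simp add: word_prod_Cons intro: mult_mem)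
qed

text \<open>
  Only nonempty prefixes of \<open>xs\<close> are counted, since the empty one has degree \<open>1\<close>, outside the support.
  There are still more of them than degrees in the support.
\<close>

lemma word_prod_eq_0:
  assumes R1: "R 1 = {0}" and fin: "finite (grading_support R)"
    and len: "card (grading_support R) < length xs" and hom: "set xs \<subseteq> homogeneous"
  shows "word_prod xs = 0"
proof (rule ccontr)
  assume nz: "word_prod xs \<noteq> 0"
  from hom have "\<forall>x\<in>set xs. \<exists>s. x \<in> R s"
    by (auto simp add: homogeneous_def)
  then obtain deg where deg: "\<forall>x\<in>set xs. x \<in> R (deg x)"
    by metis
  define ss where "ss = map deg xs"
  have ss: "list_all2 (\<lambda>x s. x \<in> R s) xs ss"
    using deg by (auto simp add: ss_def list_all2_conv_all_nth)
  define p where "p i = prod_list (take i ss)" for i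
  have "p i \<in> grading_support R" if "i \<in> {1..length xs}" for i
  proof -
    have "take i xs \<noteq> []"
      using that by auto
    moreover from this have "word_prod (take i xs) \<noteq> 0"
      using nz word_prod_eq_0_if_segment_eq_0[of "take i xs" "[]" "drop i xs"] by auto
    moreover have "word_prod (take i xs) \<in> R (p i)"
      unfolding p_def using ss \<open>take i xs \<noteq> []\<close> by (intro word_prod_mem list_all2_takeI)
    ultimately show ?thesis
      unfolding grading_support_def by blast
  qed
  then have "card (p ` {1..length xs}) \<le> card (grading_support R)"
    by (intro card_mono fin) blast
  then have "\<not> inj_on p {1..length xs}"
    using len by (intro pigeonhole) simp
  then obtain i j where ij: "i < j" "j \<le> length xs" and eq: "p i = p j"
    unfolding inj_on_def by (metis atLeastAtMost_iff linorder_neqE_nat)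
  let ?seg = "\<lambda>ys. drop i (take j ys)"
  have "p j = p i * prod_list (?seg ss)"
  proof -
    have "take j ss = take i ss @ ?seg ss"
      using ij(1) append_take_drop_id[of i "take j ss"] by (simp add: min_def)
    then show ?thesis by (metis p_def prod_list.append)
  qed
  then have "prod_list (?seg ss) = 1"
    using eq by (metis mult_eq_left_iff)
  moreover have seg: "?seg xs \<noteq> []"
    using ij by simp
  ultimately have "word_prod (?seg xs) = 0"
    using word_prod_mem[OF list_all2_dropI[OF list_all2_takeI[OF ss]] seg] R1 by simp
  moreover have "xs = take i xs @ ?seg xs @ drop j xs"
    using ij(1) by (metis append.assoc append_take_drop_id min.strict_order_iff take_take)
  ultimately show False
    using nz seg word_prod_eq_0_if_segment_eq_0 by metis
qed

lemma left_normed_commutator_eq_0_if_trivial_neutral: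
  assumes "R 1 = {0}" and "finite (grading_support R)"
    and "card (grading_support R) < length xs" and "set xs \<subseteq> homogeneous"
  shows "left_normed_commutator xs = 0"
proof -
  have "xs \<noteq> []"
    using assms(3) by auto
  moreover have "word_prod ys = 0" if "length ys = length xs" "set ys \<subseteq> homogeneous" for ys
    using that assms by (simp add: word_prod_eq_0)
  moreover have "additive (\<lambda>x. x :: 'a)"
    by (simp add: additive_def)
  ultimately show ?thesis
    using additive_left_normed_commutator_eq_0[of "\<lambda>x. x" xs homogeneous] assms(4) by blast
qed

end

section \<open>Central neutral component and small support\<close>

locale central_cancellative_grading = cancellative_grading +
  assumes central: "R 1 \<subseteq> ring_center"
begin

text \<open>
  A degree outside the support also counts as neutral: then \<open>R u = {0} \<subseteq> R 1\<close>.
\<close>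

lemma component_subset_neutral:
  assumes "grading_support R \<subseteq> insert 1 T" and "u \<notin> T"
  shows "R u \<subseteq> R 1"
proof (cases "u = 1")
  case False
  with assms have "u \<notin> grading_support R"
    by blast
  then show ?thesis
    using zero_mem by (simp add: grading_support_def)
qed simp

lemma homogeneous_cases:
  assumes "grading_support R \<subseteq> insert 1 T" and "x \<in> homogeneous"
  obtains "x \<in> R 1" | s where "s \<in> T" and "x \<in> R s"
proof -
  from assms(2) obtain s where "x \<in> R s"
    by (auto simp add: homogeneous_def)
  then show thesis
    using component_subset_neutral[OF assms(1), of s] that by blast
qed

lemma commutator_neutral_left: "z \<in> R 1 \<Longrightarrow> commutator z a = 0"
  using central commutator_center_left by blast

lemma commutator_neutral_right: "z \<in> R 1 \<Longrightarrow> commutator a z = 0"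
  using central commutator_center_right by blast

lemma commutator_mem_neutral_if_two_degrees:
  assumes supp: "grading_support R \<subseteq> {1, s}" and s: "s \<noteq> 1"
    and a: "a \<in> homogeneous" and b: "b \<in> homogeneous"
  shows "commutator a b \<in> R 1"
proof (cases "a \<in> R 1 \<or> b \<in> R 1")
  case True
  then show ?thesis
    by (auto simp add: commutator_neutral_left commutator_neutral_right zero_mem)
next
  case False
  then have ab: "a \<in> R s" "b \<in> R s"
    using homogeneous_cases[OF supp a] homogeneous_cases[OF supp b] by auto
  have "s * s \<notin> {s}"
    using s by (simp add: mult_eq_left_iff)
  with supp have "R (s * s) \<subseteq> R 1"
    by (rule component_subset_neutral)
  then show ?thesis
    using mult_mem[OF ab] mult_mem[OF ab(2,1)] unfolding commutator_def by (blast intro: diff_mem)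
qed

lemma mult_mem_neutral_if_three_degrees:
  assumes supp: "grading_support R \<subseteq> {1, s, t}" and st: "s \<noteq> 1" "t \<noteq> 1"
    and x: "x \<in> R s" and y: "y \<in> R t"
  shows "x * y \<in> R 1"
proof -
  have "s * t \<notin> {s, t}"
    using st by (simp add: mult_eq_left_iff mult_eq_right_iff)
  with supp have "R (s * t) \<subseteq> R 1"
    by (rule component_subset_neutral)
  with mult_mem[OF x y] show ?thesis by blast
qed

lemma commutator_mem_neutral_if_three_degrees:
  assumes supp: "grading_support R \<subseteq> {1, s, t}" and st: "s \<noteq> 1" "t \<noteq> 1"
    and x: "x \<in> R s" and y: "y \<in> R t"
  shows "commutator x y \<in> R 1"
proof -
  have supp': "grading_support R \<subseteq> {1, t, s}"
    using supp by blast
  show ?thesis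
    unfolding commutator_def
    using mult_mem_neutral_if_three_degrees[OF supp st x y]
      mult_mem_neutral_if_three_degrees[OF supp' st(2,1) y x]
    by (rule diff_mem)
qed

text \<open>
  Only \<open>s * s = t\<close> matters, since otherwise \<open>[a, b]\<close> is already central.  Then \<open>[a, b]\<close> has degree \<open>t\<close>, so an
  entry \<open>c\<close> of degree \<open>s\<close> brings the commutator into \<open>R 1\<close>.  For \<open>c\<close> of degree \<open>t\<close> the degree
  \<open>t * t\<close> may well be \<open>s\<close>, as in a grading by the cyclic group of order three; here the rotation of
  \<open>a\<close>, \<open>b\<close>, \<open>c\<close> shows that the commutator is zero.
\<close>

lemma double_commutator_mem_neutral_if_equal_degrees:
  assumes supp: "grading_support R \<subseteq> {1, s, t}" and st: "s \<noteq> 1" "t \<noteq> 1"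
    and a: "a \<in> R s" and b: "b \<in> R s" and c: "c \<in> R s \<union> R t"
  shows "commutator (commutator a b) c \<in> R 1"
proof (cases "s * s = t")
  case False
  then have "s * s \<notin> {s, t}"
    using st by (simp add: mult_eq_left_iff)
  with supp have "R (s * s) \<subseteq> R 1"
    by (rule component_subset_neutral)
  then have "commutator a b \<in> R 1"
    using mult_mem[OF a b] mult_mem[OF b a] unfolding commutator_def by (blast intro: diff_mem)
  then show ?thesis
    by (simp add: commutator_neutral_left zero_mem)
next
  case True
  have supp': "grading_support R \<subseteq> {1, t, s}"
    using supp by blast
  show ?thesis
  proof (cases "c \<in> R s")
    case c: True
    have "commutator a b \<in> R t"
      using mult_mem[OF a b] mult_mem[OF b a] True unfolding commutator_def
      by (auto intro: diff_mem)
    then show ?thesis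
      using commutator_mem_neutral_if_three_degrees[OF supp' st(2,1) _ c] by simp
  next
    case False
    with c have c: "c \<in> R t"
      by simp
    have "x * c \<in> ring_center" "c * x \<in> ring_center" if "x \<in> R s" for x
      using mult_mem_neutral_if_three_degrees[OF supp st that c]
        mult_mem_neutral_if_three_degrees[OF supp' st(2,1) c that] central by auto
    then have "commutator (a * b) c = 0" "commutator (b * a) c = 0"
      using a b by (auto intro: commutator_mult_eq_0)
    then show ?thesis
      unfolding commutator_def[of a b] by (simp add: commutator_minus_left zero_mem)
  qed
qed

lemma double_commutator_mem_neutral:
  assumes supp: "grading_support R \<subseteq> {1, s, t}" and st: "s \<noteq> 1" "t \<noteq> 1"
    and a: "a \<in> homogeneous" and b: "b \<in> homogeneous" and c: "c \<in> homogeneous"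
  shows "commutator (commutator a b) c \<in> R 1"
proof (cases "a \<in> R 1 \<or> b \<in> R 1 \<or> c \<in> R 1 \<or> commutator a b \<in> R 1")
  case True
  then show ?thesis
    by (auto simp add: commutator_neutral_left commutator_neutral_right zero_mem)
next
  case False
  have supp': "grading_support R \<subseteq> {1, t, s}"
    using supp by blast
  have mem: "a \<in> R s \<union> R t" "b \<in> R s \<union> R t" "c \<in> R s \<union> R t"
    using False homogeneous_cases[OF supp] a b c by (metis UnI1 UnI2 empty_iff insert_iff)+
  have "\<not> (a \<in> R s \<and> b \<in> R t)" "\<not> (a \<in> R t \<and> b \<in> R s)"
    using False commutator_mem_neutral_if_three_degrees[OF supp st]
      commutator_mem_neutral_if_three_degrees[OF supp' st(2,1)] by blast+
  with mem have "a \<in> R s \<and> b \<in> R s \<or> a \<in> R t \<and> b \<in> R t"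
    by blast
  then show ?thesis
    using double_commutator_mem_neutral_if_equal_degrees[OF supp st, of a b c]
      double_commutator_mem_neutral_if_equal_degrees[OF supp' st(2,1), of a b c] mem(3)
    by (metis Un_commute)
qed

lemma left_normed_commutator_mem_neutral:
  assumes fin: "finite (grading_support R)" and one: "1 \<in> grading_support R"
    and card: "card (grading_support R) \<in> {1, 2, 3}"
    and len: "length xs = card (grading_support R)" and hom: "set xs \<subseteq> homogeneous"
  shows "left_normed_commutator xs \<in> R 1"
proof -
  let ?T = "grading_support R - {1}"
  have supp: "grading_support R = insert 1 ?T"
    using one by blast
  have cT: "card (grading_support R) = Suc (card ?T)"
    using fin one by (metis card.remove)
  from card cT consider "card ?T = 0" | "card ?T = 1" | "card ?T = 2"
    by auto
  then show ?thesis
  proof cases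
    case 1
    then have "?T = {}"
      using fin by simp
    then have supp: "grading_support R \<subseteq> insert 1 {}"
      using supp by blast
    from len cT 1 obtain a where "xs = [a]"
      by (auto simp add: length_Suc_conv)
    then show ?thesis
      using hom homogeneous_cases[OF supp] by auto
  next
    case 2
    then obtain s where "?T = {s}"
      by (auto simp add: card_1_singleton_iff)
    then have "grading_support R \<subseteq> {1, s}" "s \<noteq> 1"
      using supp by blast+
    moreover from len cT 2 obtain a b where "xs = [a, b]"
      by (auto simp add: length_Suc_conv)
    ultimately show ?thesis
      using hom commutator_mem_neutral_if_two_degrees by simp
  next
    case 3
    then obtain s t where "?T = {s, t}"
      by (auto simp add: card_2_iff)
    then have "grading_support R \<subseteq> {1, s, t}" "s \<noteq> 1" "t \<noteq> 1"
      using supp by blast+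
    moreover from len cT 3 obtain a b c where "xs = [a, b, c]"
      by (auto simp add: length_Suc_conv numeral_2_eq_2)
    ultimately show ?thesis
      using hom double_commutator_mem_neutral by simp
  qed
qed

end

section \<open>The commutator identity\<close>

theorem theorem3p5:
  fixes R :: "'s::monoid_mult \<Rightarrow> 'a::ring set" and d :: nat
  assumes cancel_right: "\<And>\<xi> \<tau> \<zeta> :: 's. \<xi> * \<zeta> = \<tau> * \<zeta> \<Longrightarrow> \<xi> = \<tau>"
    and cancel_left: "\<And>\<xi> \<tau> \<zeta> :: 's. \<zeta> * \<xi> = \<zeta> * \<tau> \<Longrightarrow> \<xi> = \<tau>"
    and grading: "finite_grading R d"
    and central: "R 1 \<subseteq> ring_center"
    and d: "d \<in> {1, 2, 3}"
  shows "\<forall>as :: 'a list. length as = d + 1 \<longrightarrow> left_normed_commutator as = 0"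
proof (intro allI impI)
  from grading have gr: "grading R" and fin: "finite (grading_support R)"
    and card: "card (grading_support R) = d"
    by (simp_all add: finite_grading_def)
  interpret central_cancellative_grading R
    by standard (fact cancel_right cancel_left gr central)+
  fix as :: "'a list"
  assume "length as = d + 1"
  then show "left_normed_commutator as = 0"
  proof (rule left_normed_commutator_eq_0_if_homogeneous[rotated])
    fix xs :: "'a list"
    assume len: "length xs = d + 1" and hom: "set xs \<subseteq> homogeneous"
    show "left_normed_commutator xs = 0"
    proof (cases "R 1 = {0}")
      case True
      then show ?thesis
        using left_normed_commutator_eq_0_if_trivial_neutral fin card len hom by simp
    next
      case False
      then have one: "1 \<in> grading_support R"
        by (simp add: grading_support_def)
      from len obtain ys b where xs: "xs = ys @ [b]" and ys: "length ys = d"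
        by (metis Suc_eq_plus1 length_Suc_conv_rev)
      then have "ys \<noteq> []"
        using d by auto
      moreover have "left_normed_commutator ys \<in> R 1"
        using left_normed_commutator_mem_neutral[OF fin one] card d ys hom xs by simp
      ultimately show ?thesis
        by (simp add: xs left_normed_commutator_snoc commutator_neutral_left)
    qed
  qed
qed

end
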